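(* Let $0<\delta<1/2$ be a constant. There is a constant $C$, depending only on $\delta$, such that the following holds. Let $k=k(n)$ be any sequence of positive integers with $k(n)=o(n^{1/3})$ as $n\to\infty$. Then for all sufficiently large $n$ and every integer $m$ with $\delta n^2\le m\le(1-\delta)n^2$, $$\mathbb E[X_{n,m}^k]\le C^k\,(\mathbb E[X_{n,m}])^k,$$ where $X_{n,m}$ is the number of perfect matchings in $B(n,m)$.
   Context: $B(n,m)$ is the random bipartite graph chosen uniformly at random from the set of all bipartite graphs with two fixed (labeled) vertex classes of size $n$ each and exactly $m$ edges. *)

theory Defs
  imports "HOL-Probability.Probability" "HOL-Library.Landau_Symbols"
begin

text \<open>
  The two vertex classes are two disjoint copies of \<open>{..<n}\<close>; the pair \<open>(i, j)\<close> stands for the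
  edge joining vertex \<open>i\<close> of the left class to vertex \<open>j\<close> of the right class. As the vertex set
  is fixed, a bipartite graph is identified with its edge set.
\<close>

definition bipartite_graphs :: "nat \<Rightarrow> nat \<Rightarrow> (nat \<times> nat) set set" where
  "bipartite_graphs n m = {E. E \<subseteq> {..<n} \<times> {..<n} \<and> card E = m}"

text \<open>
  Only meaningful for \<open>m \<le> n\<^sup>2\<close>, when the set of graphs is nonempty.
\<close>

definition random_bipartite :: "nat \<Rightarrow> nat \<Rightarrow> (nat \<times> nat) set pmf" where
  "random_bipartite n m = pmf_of_set (bipartite_graphs n m)"

definition perfect_matchings :: "nat \<Rightarrow> (nat \<times> nat) set \<Rightarrow> (nat \<times> nat) set set" where
  "perfect_matchings n E =
     {M. M \<subseteq> E \<and> (\<forall>i<n. \<exists>!e. e \<in> M \<and> fst e = i) \<and> (\<forall>j<n. \<exists>!e. e \<in> M \<and> snd e = j)}"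

definition num_pm :: "nat \<Rightarrow> (nat \<times> nat) set \<Rightarrow> nat" where
  "num_pm n E = card (perfect_matchings n E)"

end

theory Submission
  imports Defs "HOL-Combinatorics.Permutations"
begin

text \<open>
  The moment \<open>E[X\<^sup>k]\<close> is the sum, over \<open>k\<close>-tuples of permutations, of the probability \<open>P u\<close> that
  their union, of size \<open>u = kn - s\<close>, lies in the random graph. With \<open>N = n\<^sup>2\<close> and \<open>a = (N - m) / m\<close>,
  two product estimates give \<open>P (kn) \<le> P n ^ k exp (- a k (k - 1) / 2)\<close> and
  \<open>P (kn - s) \<le> P (kn) (1 + x) ^ s\<close>, where \<open>x = (N - m) / (m - kn)\<close>. On the other hand the average
  of \<open>(1 + x) ^ s\<close> is at most \<open>exp (x k (k - 1) / 2)\<close>: adding the permutations one at a time, the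
  \<open>d\<close> earlier ones occupy at most \<open>d\<close> cells in each row, and then the number of hits of a uniform
  permutation has \<open>j\<close>-th factorial moment at most \<open>d ^ j\<close>, as for a Poisson variable. The two
  exponents differ by \<open>(x - a) k (k - 1) / 2 = O(k\<^sup>3 / n)\<close>, which tends to \<open>0\<close>.
\<close>

section \<open>Hits of a uniform permutation: factorial moments and the Poisson-type bound\<close>

text \<open>If some permutation \<open>\<tau>\<close> extends \<open>f\<close> on \<open>J\<close>,
  then composing with \<open>inv \<tau>\<close> embeds all such extensions into the permutations of
  \<open>S - J\<close>. Only an upper bound holds, since \<open>f\<close> need not be injective on
  \<open>J\<close> or map it into \<open>S\<close>.\<close>

lemma card_permutes_extending_le:
  assumes "finite S" "J \<subseteq> S"
  shows "card {\<sigma>. \<sigma> permutes S \<and> (\<forall>i\<in>J. \<sigma> i = f i)} \<le> fact (card S - card J)"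
proof (cases "\<exists>\<tau>. \<tau> permutes S \<and> (\<forall>i\<in>J. \<tau> i = f i)")
  case True
  then obtain \<tau> where \<tau>: "\<tau> permutes S" "\<And>i. i \<in> J \<Longrightarrow> \<tau> i = f i" by blast
  let ?A = "{\<sigma>. \<sigma> permutes S \<and> (\<forall>i\<in>J. \<sigma> i = f i)}" and ?B = "{\<sigma>. \<sigma> permutes S - J}"
  have "inj_on (\<lambda>\<sigma>. inv \<tau> \<circ> \<sigma>) ?A"
    by (rule inj_on_inverseI[where g = "\<lambda>\<sigma>. \<tau> \<circ> \<sigma>"])
      (simp add: o_assoc permutes_inv_o(1)[OF \<tau>(1)])
  moreover have "(\<lambda>\<sigma>. inv \<tau> \<circ> \<sigma>) ` ?A \<subseteq> ?B"
  proof clarify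
    fix \<sigma> assume \<sigma>: "\<sigma> permutes S" "\<forall>i\<in>J. \<sigma> i = f i"
    have "inv \<tau> \<circ> \<sigma> permutes S"
      by (intro permutes_compose \<sigma> permutes_inv \<tau>)
    moreover have "(inv \<tau> \<circ> \<sigma>) i = i" if "i \<in> J" for i
      using \<sigma>(2) \<tau>(2) that permutes_inverses(2)[OF \<tau>(1)] by (metis comp_apply)
    ultimately show "inv \<tau> \<circ> \<sigma> permutes S - J"
      by (auto intro: permutes_superset)
  qed
  moreover have "finite ?B" using assms by (simp add: finite_permutations)
  ultimately have "card ?A \<le> card ?B" by (rule card_inj_on_le)
  also have "card ?B = fact (card S - card J)"
    using assms by (intro card_permutations) (auto simp: card_Diff_subset finite_subset)
  finally show ?thesis .
next
  case False
  then have "{\<sigma>. \<sigma> permutes S \<and> (\<forall>i\<in>J. \<sigma> i = f i)} = {}" by blast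
  then show ?thesis by (simp only: card.empty)
qed

text \<open>A union bound over the at most \<open>d ^ card J\<close> choices of values on
  \<open>J\<close>. After division by \<open>fact (card S)\<close> and summation over all
  \<open>J\<close> of size \<open>j\<close>, this is the bound \<open>d ^ j / fact j\<close> on the
  \<open>j\<close>-th binomial moment of the number of hits.\<close>

lemma card_permutes_restricted_le:
  assumes "finite S" "J \<subseteq> S" and A: "\<And>i. i \<in> J \<Longrightarrow> finite (A i) \<and> card (A i) \<le> d"
  shows "card {\<sigma>. \<sigma> permutes S \<and> (\<forall>i\<in>J. \<sigma> i \<in> A i)} \<le> d ^ card J * fact (card S - card J)"
proof -
  have fin: "finite J" using assms finite_subset by blast
  have finP: "finite (Pi\<^sub>E J A)" using fin A by (intro finite_PiE) auto
  have "{\<sigma>. \<sigma> permutes S \<and> (\<forall>i\<in>J. \<sigma> i \<in> A i)}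
      \<subseteq> (\<Union>f\<in>Pi\<^sub>E J A. {\<sigma>. \<sigma> permutes S \<and> (\<forall>i\<in>J. \<sigma> i = f i)})"
  proof clarify
    fix \<sigma> assume "\<sigma> permutes S" "\<forall>i\<in>J. \<sigma> i \<in> A i"
    then show "\<sigma> \<in> (\<Union>f\<in>Pi\<^sub>E J A. {\<sigma>. \<sigma> permutes S \<and> (\<forall>i\<in>J. \<sigma> i = f i)})"
      by (intro UN_I[of "restrict \<sigma> J"]) auto
  qed
  then have "card {\<sigma>. \<sigma> permutes S \<and> (\<forall>i\<in>J. \<sigma> i \<in> A i)}
      \<le> card (\<Union>f\<in>Pi\<^sub>E J A. {\<sigma>. \<sigma> permutes S \<and> (\<forall>i\<in>J. \<sigma> i = f i)})"
    using finP assms(1)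
    by (intro card_mono finite_UN_I) (auto intro: finite_subset[OF _ finite_permutations])
  also have "\<dots> \<le> (\<Sum>f\<in>Pi\<^sub>E J A. card {\<sigma>. \<sigma> permutes S \<and> (\<forall>i\<in>J. \<sigma> i = f i)})"
    by (rule card_UN_le[OF finP])
  also have "\<dots> \<le> (\<Sum>f\<in>Pi\<^sub>E J A. fact (card S - card J))"
    by (intro sum_mono card_permutes_extending_le assms)
  also have "\<dots> = (\<Prod>i\<in>J. card (A i)) * fact (card S - card J)"
    by (simp add: card_PiE fin)
  also have "(\<Prod>i\<in>J. card (A i)) \<le> d ^ card J"
    using A prod_mono[of J "\<lambda>i. card (A i)" "\<lambda>_. d"] by simp
  finally show ?thesis by simp
qed

lemma sum_Pow_card:
  fixes g :: "nat \<Rightarrow> real"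
  assumes "finite S"
  shows "(\<Sum>J\<in>Pow S. g (card J)) = (\<Sum>j\<le>card S. real (card S choose j) * g j)"
proof -
  have "(\<Sum>J\<in>Pow S. g (card J)) = (\<Sum>j\<le>card S. \<Sum>J\<in>{J \<in> Pow S. card J = j}. g (card J))"
    by (rule sum.group[symmetric]) (use assms card_mono in auto)
  also have "\<dots> = (\<Sum>j\<le>card S. real (card {J. J \<subseteq> S \<and> card J = j}) * g j)"
    by (intro sum.cong) auto
  finally show ?thesis using assms by (simp add: n_subsets)
qed

lemma sum_exp_series_le:
  fixes y :: real
  assumes "0 \<le> y"
  shows "(\<Sum>j\<le>n. y ^ j / fact j) \<le> exp y"
proof -
  have "(\<Sum>j\<le>n. y ^ j / fact j) \<le> (\<Sum>j. y ^ j / fact j)"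
    using assms summable_exp[of y] by (intro sum_le_suminf) (auto simp: field_simps)
  then show ?thesis by (simp add: exp_def field_simps)
qed

text \<open>The right side, divided by the number of permutations, is the generating function at
  \<open>1 + x\<close> of a Poisson variable of mean \<open>d\<close>. Expanding the power over
  subsets of the hit rows leaves the binomial moments, and these are dominated by the Poisson
  ones.\<close>

lemma sum_permutes_power_le:
  fixes x :: real
  assumes S: "finite S" and x: "0 \<le> x" and A: "\<And>i. i \<in> S \<Longrightarrow> finite (A i) \<and> card (A i) \<le> d"
  shows "(\<Sum>\<sigma> | \<sigma> permutes S. (1 + x) ^ card {i\<in>S. \<sigma> i \<in> A i}) \<le> fact (card S) * exp (x * real d)"
proof -
  let ?n = "card S" and ?P = "{\<sigma>. \<sigma> permutes S}"
  have finP: "finite ?P" by (simp add: S finite_permutations)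
  \<comment> \<open>Every set of hit rows contributes to the expansion. The indicator extends the
    sum to all \<open>J \<subseteq> S\<close>, so that the index set no longer depends on
    \<open>\<sigma>\<close> and the sums can be swapped.\<close>
  have expand: "(1 + x) ^ card {i\<in>S. \<sigma> i \<in> A i}
      = (\<Sum>J\<in>Pow S. x ^ card J * of_bool (\<forall>i\<in>J. \<sigma> i \<in> A i))" for \<sigma>
  proof -
    let ?T = "{i\<in>S. \<sigma> i \<in> A i}"
    have "(1 + x) ^ card ?T = (\<Prod>i\<in>?T. x + 1)" by (simp add: add.commute)
    also have "\<dots> = (\<Sum>J\<in>Pow ?T. x ^ card J)"
      using S by (subst prod_add) (auto intro!: sum.cong)
    also have "\<dots> = (\<Sum>J\<in>Pow S. x ^ card J * of_bool (\<forall>i\<in>J. \<sigma> i \<in> A i))"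
      using S by (intro sum.mono_neutral_cong_left) auto
    finally show ?thesis .
  qed
  have "(\<Sum>\<sigma>\<in>?P. (1 + x) ^ card {i\<in>S. \<sigma> i \<in> A i})
      = (\<Sum>J\<in>Pow S. \<Sum>\<sigma>\<in>?P. x ^ card J * of_bool (\<forall>i\<in>J. \<sigma> i \<in> A i))"
    unfolding expand by (rule sum.swap)
  also have "\<dots> = (\<Sum>J\<in>Pow S. x ^ card J * real (card {\<sigma>. \<sigma> permutes S \<and> (\<forall>i\<in>J. \<sigma> i \<in> A i)}))"
    using finP by (simp add: sum_distrib_left[symmetric] of_bool_def sum.If_cases Int_def)
  also have "\<dots> \<le> (\<Sum>J\<in>Pow S. x ^ card J * real (d ^ card J * fact (?n - card J)))"
    by (intro sum_mono mult_left_mono of_nat_mono card_permutes_restricted_le)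
      (use S A x in auto)
  also have "\<dots> = (\<Sum>j\<le>?n. real (?n choose j) * (x ^ j * real (d ^ j * fact (?n - j))))"
    by (rule sum_Pow_card[OF S, of "\<lambda>j. x ^ j * real (d ^ j * fact (?n - j))"])
  also have "\<dots> = fact ?n * (\<Sum>j\<le>?n. (x * real d) ^ j / fact j)"
    unfolding sum_distrib_left
    by (intro sum.cong) (auto simp: binomial_fact power_mult_distrib field_simps)
  also have "\<dots> \<le> fact ?n * exp (x * real d)"
    using x by (intro mult_left_mono sum_exp_series_le) auto
  finally show ?thesis .
qed

section \<open>Perfect matchings as graphs of permutations\<close>

definition perm_edges :: "nat \<Rightarrow> (nat \<Rightarrow> nat) \<Rightarrow> (nat \<times> nat) set" where
  "perm_edges n \<sigma> = (\<lambda>i. (i, \<sigma> i)) ` {..<n}"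

lemma finite_perm_edges [simp]: "finite (perm_edges n \<sigma>)"
  by (simp add: perm_edges_def)

lemma card_perm_edges [simp]: "card (perm_edges n \<sigma>) = n"
  by (simp add: perm_edges_def card_image inj_on_def)

lemma perm_edges_subset: "\<sigma> permutes {..<n} \<Longrightarrow> perm_edges n \<sigma> \<subseteq> {..<n} \<times> {..<n}"
  by (auto simp: perm_edges_def dest: permutes_in_image)

text \<open>The row condition makes a matching the graph of a function, and the column condition
  makes this function injective, hence bijective on the finite set \<open>{..<n}\<close>.\<close>

lemma perfect_matchings_eq_image:
  assumes E: "E \<subseteq> {..<n} \<times> {..<n}"
  shows "perfect_matchings n E = perm_edges n ` {\<sigma>. \<sigma> permutes {..<n} \<and> perm_edges n \<sigma> \<subseteq> E}"
proof (intro equalityI subsetI)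
  fix M assume M: "M \<in> perfect_matchings n E"
  then have sub: "M \<subseteq> E" and row: "\<And>i. i < n \<Longrightarrow> \<exists>!e. e \<in> M \<and> fst e = i"
    and col: "\<And>j. j < n \<Longrightarrow> \<exists>!e. e \<in> M \<and> snd e = j"
    by (auto simp: perfect_matchings_def)
  \<comment> \<open>The value \<open>i\<close> outside the range is forced by
    \<open>permutes\<close>, which requires the identity off the set.\<close>
  define \<sigma> where "\<sigma> i = (if i < n then (THE j. (i, j) \<in> M) else i)" for i
  have \<sigma>: "(i, j) \<in> M \<longleftrightarrow> \<sigma> i = j" if "i < n" for i j
  proof -
    have "\<exists>!j. (i, j) \<in> M"
      using row[OF that] by (metis fst_conv prod.collapse snd_conv)
    then show ?thesis using that by (metis \<sigma>_def theI')
  qed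
  have M_eq: "M = perm_edges n \<sigma>"
  proof (intro equalityI subsetI)
    fix e assume "e \<in> M"
    then obtain i j where "e = (i, j)" "i < n" "(i, j) \<in> M" using sub E by auto
    then show "e \<in> perm_edges n \<sigma>" using \<sigma> by (auto simp: perm_edges_def)
  next
    fix e assume "e \<in> perm_edges n \<sigma>"
    then show "e \<in> M" using \<sigma> by (auto simp: perm_edges_def)
  qed
  have "inj_on \<sigma> {..<n}"
  proof (rule inj_onI)
    fix i i' assume ii: "i \<in> {..<n}" "i' \<in> {..<n}" "\<sigma> i = \<sigma> i'"
    then have m: "(i, \<sigma> i) \<in> M" "(i', \<sigma> i) \<in> M" using \<sigma> by auto
    then have "\<sigma> i < n" using sub E by auto
    from col[OF this] obtain e where "\<And>e'. e' \<in> M \<and> snd e' = \<sigma> i \<Longrightarrow> e' = e" by blast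
    from this[of "(i, \<sigma> i)"] this[of "(i', \<sigma> i)"] m have "(i, \<sigma> i) = (i', \<sigma> i)" by simp
    then show "i = i'" by simp
  qed
  moreover have "\<sigma> ` {..<n} \<subseteq> {..<n}"
  proof (rule image_subsetI)
    fix i assume "i \<in> {..<n}"
    then have "(i, \<sigma> i) \<in> M" using \<sigma> by simp
    then show "\<sigma> i \<in> {..<n}" using sub E by blast
  qed
  ultimately have "bij_betw \<sigma> {..<n} {..<n}"
    by (simp add: bij_betw_def endo_inj_surj)
  then have "\<sigma> permutes {..<n}"
    by (rule bij_imp_permutes) (simp add: \<sigma>_def)
  then show "M \<in> perm_edges n ` {\<sigma>. \<sigma> permutes {..<n} \<and> perm_edges n \<sigma> \<subseteq> E}"
    using M_eq sub by blast
next
  fix M assume "M \<in> perm_edges n ` {\<sigma>. \<sigma> permutes {..<n} \<and> perm_edges n \<sigma> \<subseteq> E}"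
  then obtain \<sigma> where \<sigma>: "\<sigma> permutes {..<n}" and sub: "M \<subseteq> E" and M: "M = perm_edges n \<sigma>"
    by blast
  have "\<exists>!e. e \<in> M \<and> fst e = i" if "i < n" for i
    using that by (auto simp: M perm_edges_def)
  moreover have "\<exists>!e. e \<in> M \<and> snd e = j" if "j < n" for j
  proof -
    from that \<sigma> obtain i where i: "i < n" "\<sigma> i = j"
      by (metis lessThan_iff permutes_image imageE)
    have "e = (i, j)" if "e \<in> M \<and> snd e = j" for e
      using that i permutes_inj[OF \<sigma>] by (auto simp: M perm_edges_def inj_eq)
    then show ?thesis using i by (intro ex1I[of _ "(i, j)"]) (auto simp: M perm_edges_def)
  qed
  ultimately show "M \<in> perfect_matchings n E"
    using sub by (auto simp: perfect_matchings_def)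
qed

lemma num_pm_eq_card_permutes:
  assumes "E \<subseteq> {..<n} \<times> {..<n}"
  shows "num_pm n E = card {\<sigma>. \<sigma> permutes {..<n} \<and> perm_edges n \<sigma> \<subseteq> E}"
proof -
  have "inj_on (perm_edges n) {\<sigma>. \<sigma> permutes {..<n}}"
  proof (rule inj_onI)
    fix \<sigma> \<tau> assume p: "\<sigma> \<in> {\<sigma>. \<sigma> permutes {..<n}}" "\<tau> \<in> {\<sigma>. \<sigma> permutes {..<n}}"
      and eq: "perm_edges n \<sigma> = perm_edges n \<tau>"
    have "\<sigma> i = \<tau> i" for i
    proof (cases "i < n")
      case True
      then have "(i, \<sigma> i) \<in> perm_edges n \<tau>" unfolding eq[symmetric] by (auto simp: perm_edges_def)
      then show ?thesis by (auto simp: perm_edges_def)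
    qed (use p in \<open>auto simp: permutes_def\<close>)
    then show "\<sigma> = \<tau>" by blast
  qed
  then show ?thesis
    unfolding num_pm_def perfect_matchings_eq_image[OF assms]
    by (intro card_image) (auto intro: inj_on_subset)
qed

section \<open>Tuples of permutations and the overlap of their edge sets\<close>

definition union_edges :: "nat \<Rightarrow> (nat \<Rightarrow> nat) list \<Rightarrow> (nat \<times> nat) set" where
  "union_edges n \<sigma>s = (\<Union>\<sigma>\<in>set \<sigma>s. perm_edges n \<sigma>)"

text \<open>Lists serve as ordered tuples with repetition, which is what a \<open>k\<close>-th power
  of a cardinality counts.\<close>

definition perm_lists :: "nat \<Rightarrow> nat \<Rightarrow> (nat \<Rightarrow> nat) list set" where
  "perm_lists n k = {\<sigma>s. set \<sigma>s \<subseteq> {\<sigma>. \<sigma> permutes {..<n}} \<and> length \<sigma>s = k}"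

lemma finite_union_edges [simp]: "finite (union_edges n \<sigma>s)"
  by (simp add: union_edges_def)

lemma union_edges_Nil [simp]: "union_edges n [] = {}"
  and union_edges_Cons [simp]: "union_edges n (\<sigma> # \<sigma>s) = perm_edges n \<sigma> \<union> union_edges n \<sigma>s"
  by (simp_all add: union_edges_def)

lemma card_union_edges_le: "card (union_edges n \<sigma>s) \<le> length \<sigma>s * n"
proof (induction \<sigma>s)
  case (Cons \<sigma> \<sigma>s)
  then show ?case using card_Un_le[of "perm_edges n \<sigma>" "union_edges n \<sigma>s"] by simp
qed simp

text \<open>Each permutation occupies one cell per row. This provides the bound \<open>d\<close>
  needed in \<open>sum_permutes_power_le\<close>.\<close>

lemma card_union_edges_row_le: "card {j. (i, j) \<in> union_edges n \<sigma>s} \<le> length \<sigma>s"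
proof -
  have "{j. (i, j) \<in> union_edges n \<sigma>s} \<subseteq> (\<lambda>\<sigma>. \<sigma> i) ` set \<sigma>s"
    by (auto simp: union_edges_def perm_edges_def)
  then have "card {j. (i, j) \<in> union_edges n \<sigma>s} \<le> card ((\<lambda>\<sigma>. \<sigma> i) ` set \<sigma>s)"
    by (simp add: card_mono)
  also have "\<dots> \<le> length \<sigma>s" by (meson card_image_le card_length finite_set le_trans)
  finally show ?thesis .
qed

lemma finite_perms: "finite {\<sigma>. \<sigma> permutes {..<n::nat}}"
  by (simp add: finite_permutations)

lemma finite_perm_lists [simp]: "finite (perm_lists n k)"
  unfolding perm_lists_def by (rule finite_lists_length_eq[OF finite_perms])

lemma card_perm_lists: "card (perm_lists n k) = fact n ^ k"
  unfolding perm_lists_def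
  by (simp add: card_lists_length_eq[OF finite_perms] card_permutations[of _ n])

lemma perm_lists_Suc:
  "perm_lists n (Suc k) = (\<lambda>(\<sigma>s, \<sigma>). \<sigma> # \<sigma>s) ` (perm_lists n k \<times> {\<sigma>. \<sigma> permutes {..<n}})"
  unfolding perm_lists_def by (rule lists_length_Suc_eq)

lemma sum_perm_lists_Suc:
  "(\<Sum>\<sigma>s\<in>perm_lists n (Suc k). f \<sigma>s)
    = (\<Sum>\<sigma>s\<in>perm_lists n k. \<Sum>\<sigma> | \<sigma> permutes {..<n}. f (\<sigma> # \<sigma>s))"
  unfolding perm_lists_Suc
  by (subst sum.reindex) (auto simp: inj_on_def sum.cartesian_product case_prod_unfold)

text \<open>The exponent is the overlap, that is, the loss against \<open>k\<close> disjoint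
  matchings. Whatever the first \<open>i\<close> permutations are, the next one multiplies the
  average by at most \<open>exp (x * i)\<close>, so the factors accumulate to the sum in the
  exponent.\<close>

lemma sum_perm_lists_overlap_le:
  fixes x :: real
  assumes x: "0 \<le> x"
  shows "(\<Sum>\<sigma>s\<in>perm_lists n k. (1 + x) ^ (k * n - card (union_edges n \<sigma>s)))
    \<le> fact n ^ k * exp (x * real (\<Sum>i<k. i))"
proof (induction k)
  case 0
  have "perm_lists n 0 = {[]}" by (auto simp: perm_lists_def)
  then show ?case by simp
next
  case (Suc k)
  let ?U = "union_edges n"
  \<comment> \<open>Inclusion-exclusion: the overlap grows by the number of cells of the new
    permutation that are already occupied. The natural subtraction does not truncate because a union
    of \<open>k\<close> matchings has at most \<open>k * n\<close> cells.\<close>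
  have step: "Suc k * n - card (?U (\<sigma> # \<sigma>s))
      = (k * n - card (?U \<sigma>s)) + card {i\<in>{..<n}. \<sigma> i \<in> {j. (i, j) \<in> ?U \<sigma>s}}"
    if "\<sigma>s \<in> perm_lists n k" for \<sigma> \<sigma>s
  proof -
    have "perm_edges n \<sigma> \<inter> ?U \<sigma>s
        = (\<lambda>i. (i, \<sigma> i)) ` {i\<in>{..<n}. \<sigma> i \<in> {j. (i, j) \<in> ?U \<sigma>s}}"
      by (auto simp: perm_edges_def)
    then have "card (perm_edges n \<sigma> \<inter> ?U \<sigma>s)
        = card {i\<in>{..<n}. \<sigma> i \<in> {j. (i, j) \<in> ?U \<sigma>s}}"
      by (simp add: card_image inj_on_def)
    moreover have "card (?U \<sigma>s) \<le> k * n"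
      using card_union_edges_le[of n \<sigma>s] that by (simp add: perm_lists_def)
    moreover have "n + card (?U \<sigma>s)
        = card (?U (\<sigma> # \<sigma>s)) + card (perm_edges n \<sigma> \<inter> ?U \<sigma>s)"
      using card_Un_Int[of "perm_edges n \<sigma>" "?U \<sigma>s"] by simp
    ultimately show ?thesis by simp
  qed
  have "(\<Sum>\<sigma>s\<in>perm_lists n (Suc k). (1 + x) ^ (Suc k * n - card (?U \<sigma>s)))
      = (\<Sum>\<sigma>s\<in>perm_lists n k. (1 + x) ^ (k * n - card (?U \<sigma>s)) *
          (\<Sum>\<sigma> | \<sigma> permutes {..<n}. (1 + x) ^ card {i\<in>{..<n}. \<sigma> i \<in> {j. (i, j) \<in> ?U \<sigma>s}}))"
    unfolding sum_perm_lists_Suc sum_distrib_left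
    by (intro sum.cong refl) (simp only: step power_add)
  also have "\<dots> \<le> (\<Sum>\<sigma>s\<in>perm_lists n k. (1 + x) ^ (k * n - card (?U \<sigma>s)) *
      (fact n * exp (x * real k)))"
  proof (intro sum_mono mult_left_mono)
    fix \<sigma>s assume \<sigma>s: "\<sigma>s \<in> perm_lists n k"
    have "finite {j. (i, j) \<in> ?U \<sigma>s}" for i
      using finite_imageI[OF finite_union_edges[of n \<sigma>s], of snd]
      by (rule finite_subset[rotated]) force
    then show "(\<Sum>\<sigma> | \<sigma> permutes {..<n}. (1 + x) ^ card {i\<in>{..<n}. \<sigma> i \<in> {j. (i, j) \<in> ?U \<sigma>s}})
        \<le> fact n * exp (x * real k)"
      using sum_permutes_power_le[of "{..<n}" x "\<lambda>i. {j. (i, j) \<in> ?U \<sigma>s}" k] x \<sigma>s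
        card_union_edges_row_le[of _ n \<sigma>s] by (simp add: perm_lists_def)
  qed (use x in auto)
  also have "\<dots> \<le> fact n ^ k * exp (x * real (\<Sum>i<k. i)) * (fact n * exp (x * real k))"
    unfolding sum_distrib_right[symmetric] by (intro mult_right_mono Suc.IH) auto
  also have "\<dots> = fact n ^ Suc k * exp (x * real (\<Sum>i<Suc k. i))"
    by (simp add: exp_add[symmetric] algebra_simps)
  finally show ?case .
qed

section \<open>Moments as sums of inclusion probabilities\<close>

lemma num_pm_power_eq:
  assumes "E \<subseteq> {..<n} \<times> {..<n}"
  shows "num_pm n E ^ k = card {\<sigma>s \<in> perm_lists n k. union_edges n \<sigma>s \<subseteq> E}"
proof -
  have "{\<sigma>s \<in> perm_lists n k. union_edges n \<sigma>s \<subseteq> E}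
      = {\<sigma>s. set \<sigma>s \<subseteq> {\<sigma>. \<sigma> permutes {..<n} \<and> perm_edges n \<sigma> \<subseteq> E} \<and> length \<sigma>s = k}"
    by (auto simp: perm_lists_def union_edges_def)
  moreover have "finite {\<sigma>. \<sigma> permutes {..<n} \<and> perm_edges n \<sigma> \<subseteq> E}"
    by (rule finite_subset[OF _ finite_perms[of n]]) auto
  ultimately show ?thesis
    by (simp add: num_pm_eq_card_permutes[OF assms] card_lists_length_eq)
qed

text \<open>Removing \<open>U\<close> leaves a free choice of the other \<open>m - card U\<close>
  elements outside it.\<close>

lemma card_supersets:
  assumes "finite V" "U \<subseteq> V" "card U \<le> m"
  shows "card {E. U \<subseteq> E \<and> E \<subseteq> V \<and> card E = m} = (card V - card U) choose (m - card U)"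
proof -
  have fin: "finite U" "\<And>F. F \<subseteq> V - U \<Longrightarrow> finite F"
    using assms by (auto intro: finite_subset)
  have "bij_betw (\<lambda>F. F \<union> U) {F. F \<subseteq> V - U \<and> card F = m - card U}
      {E. U \<subseteq> E \<and> E \<subseteq> V \<and> card E = m}"
  proof (rule bij_betw_byWitness[where f' = "\<lambda>E. E - U"])
    show "(\<lambda>F. F \<union> U) ` {F. F \<subseteq> V - U \<and> card F = m - card U} \<subseteq> {E. U \<subseteq> E \<and> E \<subseteq> V \<and> card E = m}"
    proof clarify
      fix F assume F: "F \<subseteq> V - U" "card F = m - card U"
      then have "card (F \<union> U) = card F + card U"
        by (intro card_Un_disjoint fin) auto
      then show "U \<subseteq> F \<union> U \<and> F \<union> U \<subseteq> V \<and> card (F \<union> U) = m"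
        using F assms by auto
    qed
  qed (use fin in \<open>auto simp: card_Diff_subset\<close>)
  then have "card {E. U \<subseteq> E \<and> E \<subseteq> V \<and> card E = m} = card {F. F \<subseteq> V - U \<and> card F = m - card U}"
    by (simp add: bij_betw_same_card)
  also have "\<dots> = (card V - card U) choose (m - card U)"
    using assms fin by (subst n_subsets) (auto simp: card_Diff_subset)
  finally show ?thesis .
qed

text \<open>Each step of the induction is the absorption identity for binomial coefficients, which
  yields one factor of the product.\<close>

lemma binomial_diff_eq_prod:
  assumes "u \<le> m" "m \<le> N"
  shows "real ((N - u) choose (m - u)) = real (N choose m) * (\<Prod>i<u. (real m - real i) / (real N - real i))"
  using assms(1)
proof (induction u)
  case (Suc u)
  have "(m - u) * ((N - u) choose (m - u)) = (N - u) * ((N - Suc u) choose (m - Suc u))"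
    using Suc.prems times_binomial_minus1_eq[of "m - u" "N - u"] by simp
  then have "real (m - u) * real ((N - u) choose (m - u)) = real (N - u) * real ((N - Suc u) choose (m - Suc u))"
    by (metis of_nat_mult)
  then have "real ((N - Suc u) choose (m - Suc u))
      = real ((N - u) choose (m - u)) * ((real m - real u) / (real N - real u))"
    using Suc.prems assms(2) by (simp add: of_nat_diff field_simps)
  then show ?case using Suc by (simp add: algebra_simps)
qed simp

text \<open>
  The probability that \<open>u \<le> m\<close> given cells all belong to a uniformly random set of \<open>m\<close> out of \<open>N\<close> cells.
\<close>

definition edge_prob :: "nat \<Rightarrow> nat \<Rightarrow> nat \<Rightarrow> real" where
  "edge_prob N m u = (\<Prod>i<u. (real m - real i) / (real N - real i))"

lemma edge_prob_nonneg: "u \<le> m \<Longrightarrow> m \<le> N \<Longrightarrow> 0 \<le> edge_prob N m u"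
  unfolding edge_prob_def by (intro prod_nonneg) auto

text \<open>Double counting of pairs of a graph and a tuple of matchings inside it. The number of
  graphs containing a given union depends only on the size of the union;
  \<open>k * n \<le> m\<close> ensures that every union fits.\<close>

lemma expectation_num_pm_power:
  assumes "k * n \<le> m" "m \<le> n\<^sup>2"
  shows "measure_pmf.expectation (random_bipartite n m) (\<lambda>E. real (num_pm n E) ^ k)
    = (\<Sum>\<sigma>s\<in>perm_lists n k. edge_prob (n\<^sup>2) m (card (union_edges n \<sigma>s)))"
proof -
  let ?V = "{..<n} \<times> {..<n}" and ?G = "bipartite_graphs n m"
  have V: "finite ?V" "card ?V = n\<^sup>2" by (auto simp: power2_eq_square)
  have fin: "finite ?G"
    unfolding bipartite_graphs_def by (rule finite_subset[of _ "Pow ?V"]) auto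
  have card: "card ?G = n\<^sup>2 choose m"
    unfolding bipartite_graphs_def using n_subsets[OF V(1), of m] V(2) by simp
  then have pos: "card ?G > 0" using assms(2) by simp
  then have ne: "?G \<noteq> {}" by auto
  have "(\<Sum>E\<in>?G. real (num_pm n E) ^ k)
      = (\<Sum>E\<in>?G. real (card {\<sigma>s \<in> perm_lists n k. union_edges n \<sigma>s \<subseteq> E}))"
    by (intro sum.cong) (auto simp: bipartite_graphs_def num_pm_power_eq simp flip: of_nat_power)
  also have "\<dots> = (\<Sum>E\<in>?G. \<Sum>\<sigma>s\<in>perm_lists n k. of_bool (union_edges n \<sigma>s \<subseteq> E))"
    by (simp add: of_bool_def sum.If_cases Int_def)
  also have "\<dots> = (\<Sum>\<sigma>s\<in>perm_lists n k. \<Sum>E\<in>?G. of_bool (union_edges n \<sigma>s \<subseteq> E))"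
    by (rule sum.swap)
  also have "\<dots> = (\<Sum>\<sigma>s\<in>perm_lists n k. real (card ?G) * edge_prob (n\<^sup>2) m (card (union_edges n \<sigma>s)))"
  proof (intro sum.cong refl)
    fix \<sigma>s assume \<sigma>s: "\<sigma>s \<in> perm_lists n k"
    let ?U = "union_edges n \<sigma>s"
    have sub: "?U \<subseteq> ?V"
      using \<sigma>s perm_edges_subset by (fastforce simp: perm_lists_def union_edges_def)
    have le: "card ?U \<le> m"
      using card_union_edges_le[of n \<sigma>s] \<sigma>s assms(1) by (simp add: perm_lists_def)
    have "(\<Sum>E\<in>?G. of_bool (?U \<subseteq> E)) = real (card {E. ?U \<subseteq> E \<and> E \<subseteq> ?V \<and> card E = m})"
      using fin by (simp add: of_bool_def sum.If_cases bipartite_graphs_def)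
        (auto intro!: arg_cong[where f = card])
    also have "\<dots> = real ((n\<^sup>2 - card ?U) choose (m - card ?U))"
      using card_supersets[OF V(1) sub le] V(2) by simp
    also have "\<dots> = real (card ?G) * edge_prob (n\<^sup>2) m (card ?U)"
      using binomial_diff_eq_prod[OF le assms(2)] by (simp add: card edge_prob_def)
    finally show "(\<Sum>E\<in>?G. of_bool (?U \<subseteq> E)) = real (card ?G) * edge_prob (n\<^sup>2) m (card ?U)" .
  qed
  also have "\<dots> = real (card ?G) * (\<Sum>\<sigma>s\<in>perm_lists n k. edge_prob (n\<^sup>2) m (card (union_edges n \<sigma>s)))"
    by (simp add: sum_distrib_left)
  finally show ?thesis
    unfolding random_bipartite_def using pos by (simp add: integral_pmf_of_set[OF ne fin])
qed

lemma expectation_num_pm: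
  assumes "n \<le> m" "m \<le> n\<^sup>2"
  shows "measure_pmf.expectation (random_bipartite n m) (\<lambda>E. real (num_pm n E))
    = fact n * edge_prob (n\<^sup>2) m n"
proof -
  have "card (union_edges n \<sigma>s) = n" if "\<sigma>s \<in> perm_lists n 1" for \<sigma>s
    using that by (auto simp: perm_lists_def length_Suc_conv)
  then show ?thesis
    using expectation_num_pm_power[of 1 n m] assms card_perm_lists[of n 1] by simp
qed

section \<open>Product estimates for the inclusion probability\<close>

text \<open>Dropping the factor with index \<open>v\<close> multiplies by its reciprocal
  \<open>1 + (N - m) / (m - v)\<close>. As \<open>v < u\<close>, this is at most the same expression
  with \<open>u\<close> in place of \<open>v\<close>.\<close>

lemma edge_prob_diff_le:
  assumes "s \<le> u" "u < m" "m \<le> N"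
  shows "edge_prob N m (u - s) \<le> edge_prob N m u * (1 + (real N - real m) / (real m - real u)) ^ s"
  using assms(1)
proof (induction s)
  case (Suc s)
  define v where "v = u - Suc s"
  let ?l = "1 + (real N - real m) / (real m - real u)"
  let ?r = "(real m - real v) / (real N - real v)"
  have v: "u - s = Suc v" "v < u" using Suc.prems by (auto simp: v_def)
  have pos: "real m - real v > 0" "real N - real v > 0" using assms v by auto
  have "1 + (real N - real m) / (real m - real v)
      = ((real m - real v) + (real N - real m)) / (real m - real v)"
    unfolding add_divide_distrib using pos by simp
  then have "1 = ?r * (1 + (real N - real m) / (real m - real v))"
    using pos by simp
  also have "\<dots> \<le> ?r * ?l"
    using assms v by (intro mult_left_mono add_left_mono divide_left_mono) auto
  finally have "edge_prob N m v \<le> edge_prob N m v * (?r * ?l)"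
    using edge_prob_nonneg[of v m N] v assms mult_left_mono[of 1 "?r * ?l" "edge_prob N m v"] by simp
  also have "\<dots> = edge_prob N m (u - s) * ?l"
    unfolding v by (simp add: edge_prob_def)
  also have "\<dots> \<le> edge_prob N m u * ?l ^ s * ?l"
    using Suc assms by (intro mult_right_mono) auto
  finally show ?case by (simp add: v_def algebra_simps)
qed simp

lemma edge_prob_add:
  "edge_prob N m (u + v) = edge_prob N m u * (\<Prod>i<v. (real m - real (u + i)) / (real N - real (u + i)))"
  by (induction v) (simp_all add: edge_prob_def)

text \<open>The quotient of the two ratios is exactly \<open>1 - t\<close> with
  \<open>t = b * (N - m) / ((m - i) * (N - i - b))\<close>. Enlarging the denominator to
  \<open>m * N\<close> and using \<open>1 - t \<le> exp (- t)\<close> gives the bound.\<close>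

lemma shifted_ratio_le:
  fixes m N b i :: real
  assumes "0 \<le> i" "0 \<le> b" "b + i < m" "m \<le> N"
  shows "(m - (b + i)) / (N - (b + i)) \<le> (m - i) / (N - i) * exp (- (b * (N - m) / (m * N)))"
proof -
  define t where "t = b * (N - m) / ((m - i) * (N - i - b))"
  have pos: "m - i > 0" "N - i > 0" "N - i - b > 0" "m > 0" "N > 0" using assms by auto
  have "(m - (b + i)) / (N - (b + i)) = (m - i) / (N - i) * (1 - t)"
    unfolding t_def using pos by (simp add: divide_simps) (simp add: algebra_simps)
  also have "\<dots> \<le> (m - i) / (N - i) * exp (- (b * (N - m) / (m * N)))"
  proof (intro mult_left_mono)
    have "b * (N - m) / (m * N) \<le> t"
      unfolding t_def using assms pos by (intro divide_left_mono mult_mono) auto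
    moreover have "1 - t \<le> exp (- t)" using exp_ge_add_one_self[of "- t"] by simp
    moreover have "exp (- t) \<le> exp (- (b * (N - m) / (m * N)))"
      using calculation(1) by simp
    ultimately show "1 - t \<le> exp (- (b * (N - m) / (m * N)))" by linarith
  qed (use pos in auto)
  finally show ?thesis .
qed

text \<open>The \<open>k * n\<close> factors are cut into \<open>k\<close> blocks of length
  \<open>n\<close>. The block starting at \<open>j * n\<close> is compared factor by factor with the
  first block, and the loss in the exponent is \<open>j * (N - m) / m\<close>, where
  \<open>N\<close> is \<open>n\<^sup>2\<close>.\<close>

lemma edge_prob_mult_le:
  assumes "k * n < m" "m \<le> n\<^sup>2"
  shows "edge_prob (n\<^sup>2) m (k * n)
    \<le> edge_prob (n\<^sup>2) m n ^ k * exp (- ((real n)\<^sup>2 - real m) / real m * real (\<Sum>i<k. i))"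
  using assms(1)
proof (induction k)
  case (Suc k)
  let ?N = "(real n)\<^sup>2"
  let ?q = "(?N - real m) / real m"
  have lt: "k * n + n < m" using Suc.prems by (simp add: algebra_simps)
  have m: "real m > 0" and mN: "real m \<le> ?N"
    using lt assms(2) by (simp, simp flip: of_nat_power)
  then have N: "n > 0" by (cases n) auto
  have fac: "(\<Prod>i<n. (real m - real (k * n + i)) / (?N - real (k * n + i)))
      \<le> (\<Prod>i<n. (real m - real i) / (?N - real i) * exp (- (real (k * n) * (?N - real m) / (real m * ?N))))"
  proof (intro prod_mono conjI)
    fix i assume i: "i \<in> {..<n}"
    then have "k * n + i < m" using lt by simp
    then have *: "real (k * n) + real i < real m" by linarith
    then show "0 \<le> (real m - real (k * n + i)) / (?N - real (k * n + i))"
      using mN by (intro divide_nonneg_nonneg) linarith+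
    show "(real m - real (k * n + i)) / (?N - real (k * n + i))
        \<le> (real m - real i) / (?N - real i) * exp (- (real (k * n) * (?N - real m) / (real m * ?N)))"
      using shifted_ratio_le[of "real i" "real (k * n)" "real m" ?N] * mN by simp
  qed
  have "(\<Prod>i<n. (real m - real i) / (?N - real i) * exp (- (real (k * n) * (?N - real m) / (real m * ?N))))
      = edge_prob (n\<^sup>2) m n * exp (- ?q * real k)"
  proof -
    \<comment> \<open>Here \<open>n\<close> equal exponents with shift \<open>k * n\<close> are
      collected; the two factors \<open>n\<close> cancel against \<open>n\<^sup>2\<close>.\<close>
    have "real n * (- (real (k * n) * (?N - real m) / (real m * ?N))) = - ?q * real k"
      using N m by (simp add: field_simps power2_eq_square)
    then have "exp (- (real (k * n) * (?N - real m) / (real m * ?N))) ^ n = exp (- ?q * real k)"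
      by (simp only: exp_of_nat_mult[symmetric])
    then show ?thesis
      unfolding prod.distrib by (simp add: edge_prob_def)
  qed
  with fac have fac: "(\<Prod>i<n. (real m - real (k * n + i)) / (?N - real (k * n + i)))
      \<le> edge_prob (n\<^sup>2) m n * exp (- ?q * real k)" by simp
  have "edge_prob (n\<^sup>2) m (Suc k * n)
      = edge_prob (n\<^sup>2) m (k * n) * (\<Prod>i<n. (real m - real (k * n + i)) / (?N - real (k * n + i)))"
    using edge_prob_add[of "n\<^sup>2" m "k * n" n] by (simp add: add.commute)
  also have "\<dots> \<le> (edge_prob (n\<^sup>2) m n ^ k * exp (- ?q * real (\<Sum>i<k. i))) *
      (edge_prob (n\<^sup>2) m n * exp (- ?q * real k))"
  proof (rule mult_mono)
    show "0 \<le> (\<Prod>i<n. (real m - real (k * n + i)) / (?N - real (k * n + i)))"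
    proof (intro prod_nonneg divide_nonneg_nonneg)
      fix i assume "i \<in> {..<n}"
      then have "k * n + i < m" using lt by simp
      then have "real (k * n + i) < real m" by (simp only: of_nat_less_iff)
      then show "0 \<le> real m - real (k * n + i)" "0 \<le> ?N - real (k * n + i)"
        using mN by linarith+
    qed
  qed (use Suc lt fac assms edge_prob_nonneg in \<open>auto simp: minus_divide_left\<close>)
  also have "\<dots> = edge_prob (n\<^sup>2) m n ^ Suc k * exp (- ?q * real (\<Sum>i<Suc k. i))"
    by (simp only: sum.lessThan_Suc of_nat_add distrib_left exp_add power_Suc)
      (simp only: mult_ac)
  finally show ?case by (simp add: minus_divide_left)
qed (simp add: edge_prob_def)

section \<open>The moment inequality and its asymptotic form\<close>

text \<open>The gain from overlaps, \<open>exp (x * ?S)\<close>, nearly cancels the loss from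
  drawing edges without replacement, \<open>exp (- (?N - m) / m * ?S)\<close>. The exponent left
  over contains only the difference of the two rates.\<close>

lemma expectation_num_pm_power_le:
  assumes "k * n < m" "m \<le> n\<^sup>2"
  shows "measure_pmf.expectation (random_bipartite n m) (\<lambda>E. real (num_pm n E) ^ k)
    \<le> exp (((real n)\<^sup>2 - real m) * (1 / (real m - real (k * n)) - 1 / real m) * real (\<Sum>i<k. i))
      * (fact n * edge_prob (n\<^sup>2) m n) ^ k"
proof -
  let ?U = "\<lambda>\<sigma>s. card (union_edges n \<sigma>s)" and ?P = "edge_prob (n\<^sup>2) m"
  let ?N = "(real n)\<^sup>2" and ?S = "real (\<Sum>i<k. i)"
  define x where "x = (?N - real m) / (real m - real (k * n))"
  have less: "real (k * n) < real m" using assms(1) by (simp only: of_nat_less_iff)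
  have mN: "real m \<le> ?N" using assms(2) by (simp flip: of_nat_power)
  have x: "0 \<le> x" unfolding x_def using less mN by (intro divide_nonneg_nonneg) auto
  have nonneg: "0 \<le> ?P (k * n)"
    using assms by (intro edge_prob_nonneg) auto
  have "measure_pmf.expectation (random_bipartite n m) (\<lambda>E. real (num_pm n E) ^ k)
      = (\<Sum>\<sigma>s\<in>perm_lists n k. ?P (?U \<sigma>s))"
    using assms by (intro expectation_num_pm_power) auto
  also have "\<dots> \<le> (\<Sum>\<sigma>s\<in>perm_lists n k. ?P (k * n) * (1 + x) ^ (k * n - ?U \<sigma>s))"
  proof (rule sum_mono)
    fix \<sigma>s assume "\<sigma>s \<in> perm_lists n k"
    then have "?U \<sigma>s \<le> k * n"
      using card_union_edges_le[of n \<sigma>s] by (simp add: perm_lists_def)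
    then show "?P (?U \<sigma>s) \<le> ?P (k * n) * (1 + x) ^ (k * n - ?U \<sigma>s)"
      using edge_prob_diff_le[of "k * n - ?U \<sigma>s" "k * n" m "n\<^sup>2"] assms by (simp add: x_def)
  qed
  also have "\<dots> \<le> ?P (k * n) * (fact n ^ k * exp (x * ?S))"
    unfolding sum_distrib_left[symmetric]
    by (intro mult_left_mono sum_perm_lists_overlap_le x nonneg)
  also have "\<dots> \<le> (?P n ^ k * exp (- (?N - real m) / real m * ?S)) * (fact n ^ k * exp (x * ?S))"
    by (intro mult_right_mono edge_prob_mult_le assms) auto
  also have "\<dots> = exp (- (?N - real m) / real m * ?S + x * ?S) * (fact n * ?P n) ^ k"
    by (simp add: exp_add power_mult_distrib)
  also have "- (?N - real m) / real m * ?S + x * ?S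
      = (?N - real m) * (1 / (real m - real (k * n)) - 1 / real m) * ?S"
    by (simp add: x_def algebra_simps diff_divide_distrib)
  finally show ?thesis .
qed

theorem lemma2p7:
  fixes \<delta> :: real
  assumes "0 < \<delta>" and "\<delta> < 1 / 2"
  shows "\<exists>C::real. \<forall>k::nat \<Rightarrow> nat.
    (\<forall>n. 0 < k n) \<longrightarrow> (\<lambda>n. real (k n)) \<in> o(\<lambda>n. real n powr (1 / 3)) \<longrightarrow>
    (\<forall>\<^sub>F n in sequentially. \<forall>m::nat.
       \<delta> * (real n)^2 \<le> real m \<and> real m \<le> (1 - \<delta>) * (real n)^2 \<longrightarrow>
       measure_pmf.expectation (random_bipartite n m) (\<lambda>E. real (num_pm n E) ^ k n)
         \<le> C ^ k n * (measure_pmf.expectation (random_bipartite n m) (\<lambda>E. real (num_pm n E))) ^ k n)"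
\<comment> \<open>The leftover exponent will be at most \<open>1\<close>, hence at most
  \<open>k n\<close>, so the excess factor is at most \<open>exp 1 ^ k n\<close>.\<close>
proof (intro exI[of _ "exp 1"] allI impI)
  fix k :: "nat \<Rightarrow> nat"
  assume k: "\<forall>n. 0 < k n" and small: "(\<lambda>n. real (k n)) \<in> o(\<lambda>n. real n powr (1 / 3))"
  \<comment> \<open>Chosen so that eventually \<open>k n ^ 3 \<le> \<delta>\<^sup>2 / 2 * n\<close>,
    which makes the final bound on the exponent equal to \<open>1\<close>.\<close>
  define c where "c = (\<delta>\<^sup>2 / 2) powr (1 / 3)"
  have c: "0 < c" "c ^ 3 = \<delta>\<^sup>2 / 2"
    using assms(1) by (simp_all add: c_def flip: powr_numeral) (simp_all add: powr_powr)
  have "\<forall>\<^sub>F n in sequentially. norm (real (k n)) \<le> c * norm (real n powr (1 / 3))"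
    using landau_o.smallD[OF small c(1)] .
  then show "\<forall>\<^sub>F n in sequentially. \<forall>m::nat.
       \<delta> * (real n)^2 \<le> real m \<and> real m \<le> (1 - \<delta>) * (real n)^2 \<longrightarrow>
       measure_pmf.expectation (random_bipartite n m) (\<lambda>E. real (num_pm n E) ^ k n)
         \<le> exp 1 ^ k n * (measure_pmf.expectation (random_bipartite n m) (\<lambda>E. real (num_pm n E))) ^ k n"
    using eventually_gt_at_top[of 0]
  proof eventually_elim
    case (elim n)
    show ?case
    proof (intro allI impI)
      fix m :: nat
      assume m: "\<delta> * (real n)\<^sup>2 \<le> real m \<and> real m \<le> (1 - \<delta>) * (real n)\<^sup>2"
      let ?K = "real (k n)" and ?n = "real n" and ?M = "real m"
      have n: "0 < ?n" and K: "1 \<le> ?K" using elim(2) k by (simp_all add: Suc_le_eq)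
      have "?K ^ 3 \<le> (c * ?n powr (1 / 3)) ^ 3"
        using elim(1) by (intro power_mono) auto
      also have "\<dots> = \<delta>\<^sup>2 / 2 * ?n"
        using n by (simp add: power_mult_distrib c(2) flip: powr_numeral) (simp add: powr_powr)
      finally have K3: "?K ^ 3 \<le> \<delta>\<^sup>2 / 2 * ?n" .
      \<comment> \<open>The cubic bound also gives a linear one, so the union takes up at most half
        of the \<open>m\<close> edges and \<open>m - k n * n\<close> stays comparable to
        \<open>m\<close>.\<close>
      have "?K \<le> ?K ^ 3" using K by (intro self_le_power) auto
      moreover have "\<delta>\<^sup>2 / 2 * ?n \<le> \<delta> / 2 * ?n"
        using assms n by (intro mult_right_mono) (auto simp: power2_eq_square)
      ultimately have "?K \<le> \<delta> / 2 * ?n" using K3 by linarith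
      then have "?K * ?n \<le> \<delta> / 2 * ?n * ?n" using n by (intro mult_right_mono) auto
      then have half: "?K * ?n \<le> ?M / 2" using m by (simp add: power2_eq_square)
      have "0 < \<delta> * ?n\<^sup>2" using assms n by simp
      then have Mpos: "0 < ?M" using m by linarith
      then have "real (k n * n) < ?M" using half by simp
      then have less: "k n * n < m" by (simp only: of_nat_less_iff)
      have le: "?M \<le> ?n\<^sup>2"
      proof -
        have "(1 - \<delta>) * ?n\<^sup>2 \<le> 1 * ?n\<^sup>2" using assms by (intro mult_right_mono) auto
        then show ?thesis using m by linarith
      qed
      then have le': "m \<le> n\<^sup>2" by (simp flip: of_nat_power)
      have "n \<le> k n * n" using k by (simp add: Suc_le_eq)
      then have "n \<le> m" using less by linarith
      \<comment> \<open>The crude bound by the square is enough; the sharp value is about half of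
        it.\<close>
      have S: "real (\<Sum>i<k n. i) \<le> ?K * ?K"
        using sum_bounded_above[of "{..<k n}" real ?K] by simp
      have D: "1 / (?M - ?K * ?n) - 1 / ?M \<le> 2 * ?K * ?n / ?M\<^sup>2"
      proof -
        have pos: "?M / 2 \<le> ?M - ?K * ?n" using half by simp
        have "1 / (?M - ?K * ?n) - 1 / ?M = ?K * ?n / (?M * (?M - ?K * ?n))"
          using Mpos pos by (simp add: field_simps)
        also have "\<dots> \<le> ?K * ?n / (?M * (?M / 2))"
          using Mpos pos by (intro divide_left_mono mult_left_mono mult_pos_pos) auto
        finally show ?thesis by (simp add: power2_eq_square mult_ac)
      qed
      have "(?n\<^sup>2 - ?M) * (1 / (?M - ?K * ?n) - 1 / ?M) * real (\<Sum>i<k n. i)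
          \<le> ?n\<^sup>2 * (2 * ?K * ?n / ?M\<^sup>2) * (?K * ?K)"
        using le Mpos D S half
        by (intro mult_mono) (auto intro: sum_nonneg simp: field_simps)
      also have "\<dots> = 2 * ?K ^ 3 * ?n ^ 3 / ?M\<^sup>2"
        by (simp add: power2_eq_square power3_eq_cube)
      \<comment> \<open>Both assumptions enter here: the cubic bound on \<open>k n\<close> in the
        numerator and the density bound \<open>m \<ge> \<delta> * n\<^sup>2\<close> in the
        denominator.\<close>
      also have "\<dots> \<le> 2 * (\<delta>\<^sup>2 / 2 * ?n) * ?n ^ 3 / (\<delta> * ?n\<^sup>2)\<^sup>2"
        using K3 m assms n by (intro frac_le mult_right_mono mult_left_mono power_mono) auto
      also have "\<dots> = 1"
        using assms n by (simp add: field_simps power2_eq_square power3_eq_cube)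
      finally have expo: "(?n\<^sup>2 - ?M) * (1 / (?M - real (k n * n)) - 1 / ?M) * real (\<Sum>i<k n. i) \<le> ?K"
        using K by simp
      have "0 \<le> fact n * edge_prob (n\<^sup>2) m n"
        using edge_prob_nonneg[OF \<open>n \<le> m\<close> le'] by simp
      then have "exp ((?n\<^sup>2 - ?M) * (1 / (?M - real (k n * n)) - 1 / ?M) * real (\<Sum>i<k n. i))
            * (fact n * edge_prob (n\<^sup>2) m n) ^ k n
          \<le> exp ?K * (fact n * edge_prob (n\<^sup>2) m n) ^ k n"
        using expo by (intro mult_right_mono) auto
      then show "measure_pmf.expectation (random_bipartite n m) (\<lambda>E. real (num_pm n E) ^ k n)
         \<le> exp 1 ^ k n * (measure_pmf.expectation (random_bipartite n m) (\<lambda>E. real (num_pm n E))) ^ k n"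
        using expectation_num_pm_power_le[OF less le']
        by (simp add: expectation_num_pm[OF \<open>n \<le> m\<close> le'] flip: exp_of_nat_mult)
    qed
  qed
qed

end
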